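(* Let $\alpha=(\alpha_n)_{n\ge1}$ be a strictly increasing, positive, finitely nuclear sequence which is unstable. Then $\delta(\mathcal{K}_{\alpha})\neq\delta\big(\Lambda_{1}((\alpha_{n+1})_{n\ge0})\big)$.
   Context: **Power series spaces of finite type.** For a non-negative increasing sequence $\beta=(\beta_n)_{n\ge n_0}$ (indexed from $n_0=0$ or $n_0=1$) with $\beta_n\to+\infty$, $\Lambda_1(\beta)=\{x=(x_n)_{n\ge n_0}:\|x\|_k=\sum_n|x_n|e^{-\beta_n/k}<\infty\ \forall k\ge1\}$. In particular $(\alpha_{n+1})_{n\ge0}=(\alpha_1,\alpha_2,\dots)$ is the sequence $\alpha$ re-indexed from $0$. The sequence $\alpha$ is finitely nuclear if $\Lambda_1(\alpha)$ is nuclear, equivalently $\lim_n\ln(n)/\alpha_n=0$. It is unstable if $\lim_n\alpha_{n+1}/\alpha_n=+\infty$. **The space $\mathcal K_\alpha$.** For $s\in\{1,2,\dots\}$ let $I_s=\{\frac{s(s+1)}2+ys+\frac{y(y-1)}2:\ y=0,1,2,\dots\}$. The sets $I_s$ are infinite, pairwise disjoint, and their union is $\{1,2,3,\dots\}$. For $k,n\ge1$ with $n\in I_s$ put $$a_{k,n}=\begin{cases}e^{-\frac1k\alpha_n},&k\le s,\\ e^{(-\frac1k+1)\alpha_n},&k\ge s+1.\end{cases}$$ Then $\mathcal K_\alpha=\{x=(x_n)_{n\ge1}:\|x\|_k=\sum_n|x_n|a_{k,n}<\infty\ \forall k\ge1\}$, a Fréchet space with the seminorms $\|\cdot\|_k$.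 **Diameters.** For absolutely convex sets $U,V$ in a Fréchet space $E$ with $V\subseteq CU$ for some $C>0$, the $n$-th Kolmogorov diameter ($n=0,1,2,\dots$) is $d_n(V,U)=\inf\{t>0:\ V\subseteq tU+L \text{ for some linear subspace } L\subseteq E,\ \dim L\le n\}$. **Approximate diametral dimension.** For a Fréchet space $E$ with increasing fundamental seminorms $\|\cdot\|_k$ and $U_k=\{x:\|x\|_k\le1\}$, $$\delta(E)=\{(t_n)_{n\ge0}:\exists\, U\ \exists\, B\ \lim_n t_n/d_n(B,U)=0\}=\{(t_n)_{n\ge0}:\exists p\ \forall q>p\ \lim_n t_n/d_n(U_q,U_p)=0\},$$ where $U$ ranges over zero neighbourhoods and $B$ over bounded sets (the last equality is known for Fréchet spaces). *)

theory Defs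
  imports "HOL-Analysis.Analysis" "HOL-Library.Function_Algebras"
begin

text \<open>
  The scalars are an arbitrary \<open>real_normed_field\<close>: by the Gelfand--Mazur theorem
  this covers the real and the complex numbers and nothing else.  A sequence indexed
  by a set \<open>N\<close> of natural numbers is a function on \<open>nat\<close> that vanishes outside \<open>N\<close>.
\<close>

definition seq_scale :: "'a::field \<Rightarrow> (nat \<Rightarrow> 'a) \<Rightarrow> nat \<Rightarrow> 'a"
  where "seq_scale c x = (\<lambda>n. c * x n)"

global_interpretation seq: vector_space "seq_scale :: 'a::field \<Rightarrow> (nat \<Rightarrow> 'a) \<Rightarrow> nat \<Rightarrow> 'a"
  by unfold_locales (auto simp: seq_scale_def fun_eq_iff algebra_simps)

text \<open>
  A sequence space together with an increasing fundamental system of seminorms.  The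
  seminorms are indexed by \<open>k \<ge> 1\<close>; the entry at \<open>k = 0\<close> is never used.
\<close>

record 'a seminormed_space =
  points :: "(nat \<Rightarrow> 'a) set"
  seminorm :: "nat \<Rightarrow> (nat \<Rightarrow> 'a) \<Rightarrow> real"

definition absolutely_convex :: "(nat \<Rightarrow> 'a::real_normed_field) set \<Rightarrow> bool"
  where "absolutely_convex U \<longleftrightarrow>
    (\<forall>x\<in>U. \<forall>y\<in>U. \<forall>a b. norm a + norm b \<le> 1 \<longrightarrow> seq_scale a x + seq_scale b y \<in> U)"

definition zero_neighbourhood ::
    "'a::real_normed_field seminormed_space \<Rightarrow> (nat \<Rightarrow> 'a) set \<Rightarrow> bool"
  where "zero_neighbourhood E U \<longleftrightarrow>
    U \<subseteq> points E \<and> (\<exists>k\<ge>1. \<exists>e>0. {x \<in> points E. seminorm E k x \<le> e} \<subseteq> U)"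

definition bounded_in ::
    "'a::real_normed_field seminormed_space \<Rightarrow> (nat \<Rightarrow> 'a) set \<Rightarrow> bool"
  where "bounded_in E B \<longleftrightarrow>
    B \<subseteq> points E \<and> (\<forall>k\<ge>1. \<exists>M. \<forall>x\<in>B. seminorm E k x \<le> M)"


subsection \<open>Nuclear spaces\<close>

text \<open>
  For every \<open>p\<close> there is a \<open>q\<close> such that the canonical map \<open>E\<^sub>q \<rightarrow> E\<^sub>p\<close> between the local
  Banach spaces is nuclear.  The completions do not show up in the formula: a functional on
  \<open>E\<^sub>q\<close> of norm at most \<open>c j\<close> is a linear functional on \<open>E\<close> bounded by \<open>c j\<close> times the \<open>q\<close>-th
  seminorm, and the vectors \<open>y j\<close> of the completion \<open>E\<^sub>p\<close> may be taken from its dense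
  subspace \<open>E\<close>, because each of them is the sum of an absolutely convergent series from \<open>E\<close>
  with sum of norms at most twice the norm of \<open>y j\<close>.
\<close>

definition nuclear_space :: "'a::real_normed_field seminormed_space \<Rightarrow> bool"
  where "nuclear_space E \<longleftrightarrow>
    (\<forall>p\<ge>1. \<exists>q\<ge>1. \<exists>(f :: nat \<Rightarrow> (nat \<Rightarrow> 'a) \<Rightarrow> 'a) (y :: nat \<Rightarrow> nat \<Rightarrow> 'a) (c :: nat \<Rightarrow> real).
        (\<forall>j. \<forall>u\<in>points E. \<forall>v\<in>points E. f j (u + v) = f j u + f j v) \<and>
        (\<forall>j. \<forall>u\<in>points E. \<forall>b. f j (seq_scale b u) = b * f j u) \<and>
        (\<forall>j. 0 \<le> c j \<and> (\<forall>u\<in>points E. norm (f j u) \<le> c j * seminorm E q u)) \<and>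
        (\<forall>j. y j \<in> points E) \<and>
        summable (\<lambda>j. c j * seminorm E p (y j)) \<and>
        (\<forall>u\<in>points E.
          (\<lambda>m. seminorm E p (u - (\<Sum>j<m. seq_scale (f j u) (y j)))) \<longlonglongrightarrow> 0))"


subsection \<open>Kolmogorov diameters and the approximate diametral dimension\<close>

text \<open>
  The dimension bound is expressed by a basis, since \<open>seq.dim\<close> is \<open>0\<close> for
  infinite-dimensional subspaces.
\<close>

definition dim_at_most :: "nat \<Rightarrow> (nat \<Rightarrow> 'a::field) set \<Rightarrow> bool"
  where "dim_at_most n L \<longleftrightarrow>
    (\<exists>b. seq.independent b \<and> seq.span b = L \<and> finite b \<and> card b \<le> n)"

definition kolmogorov_diameter ::
    "'a::real_normed_field seminormed_space \<Rightarrow> nat \<Rightarrow> (nat \<Rightarrow> 'a) set \<Rightarrow> (nat \<Rightarrow> 'a) set \<Rightarrow> real"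
  where "kolmogorov_diameter E n V U =
    Inf {t. t > 0 \<and> (\<exists>L. L \<subseteq> points E \<and> seq.subspace L \<and> dim_at_most n L \<and>
              V \<subseteq> {seq_scale (of_real t) u + l | u l. u \<in> U \<and> l \<in> L})}"

text \<open>
  In HOL division by \<open>0\<close> yields \<open>0\<close>, and a diameter \<open>d\<^sub>n(B, U)\<close> may vanish (for instance
  for \<open>B = {0}\<close>).  The second conjunct excludes these spurious limits: where the
  denominator is \<open>0\<close>, the quotient \<open>t\<^sub>n / d\<^sub>n(B, U)\<close> counts as infinite unless \<open>t\<^sub>n = 0\<close>.
\<close>

definition approx_diametral_dimension ::
    "'a::real_normed_field seminormed_space \<Rightarrow> (nat \<Rightarrow> 'a) set"
  where "approx_diametral_dimension E = {t. \<exists>U B.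
    zero_neighbourhood E U \<and> absolutely_convex U \<and>
    bounded_in E B \<and> absolutely_convex B \<and>
    (\<lambda>n. t n / of_real (kolmogorov_diameter E n B U)) \<longlonglongrightarrow> 0 \<and>
    (\<forall>\<^sub>F n in sequentially. kolmogorov_diameter E n B U = 0 \<longrightarrow> t n = 0)}"


subsection \<open>The sequence spaces\<close>

definition koethe_space ::
    "nat set \<Rightarrow> (nat \<Rightarrow> nat \<Rightarrow> real) \<Rightarrow> 'a::real_normed_field seminormed_space"
  where "koethe_space N a =
    \<lparr> points = {x. (\<forall>n. n \<notin> N \<longrightarrow> x n = 0) \<and>
                   (\<forall>k\<ge>1. (\<lambda>n. norm (x n) * a k n) summable_on N)},
      seminorm = (\<lambda>k x. \<Sum>\<^sub>\<infinity>n\<in>N. norm (x n) * a k n) \<rparr>"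

text \<open>\<open>\<Lambda>\<^sub>1(\<beta>)\<close> for a sequence \<open>\<beta>\<close> indexed from \<open>n0\<close>.\<close>

definition Lambda1 :: "nat \<Rightarrow> (nat \<Rightarrow> real) \<Rightarrow> 'a::real_normed_field seminormed_space"
  where "Lambda1 n0 \<beta> = koethe_space {n0..} (\<lambda>k n. exp (- \<beta> n / real k))"

definition I_set :: "nat \<Rightarrow> nat set"
  where "I_set s = {s * (s + 1) div 2 + y * s + y * (y - 1) div 2 | y. True}"

definition I_index :: "nat \<Rightarrow> nat"
  where "I_index n = (THE s. 1 \<le> s \<and> n \<in> I_set s)"

definition K_weight :: "(nat \<Rightarrow> real) \<Rightarrow> nat \<Rightarrow> nat \<Rightarrow> real"
  where "K_weight \<alpha> k n =
    (if k \<le> I_index n then exp (- (1 / real k) * \<alpha> n)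
     else exp ((- (1 / real k) + 1) * \<alpha> n))"

definition K_space :: "(nat \<Rightarrow> real) \<Rightarrow> 'a::real_normed_field seminormed_space"
  where "K_space \<alpha> = koethe_space {1..} (K_weight \<alpha>)"

text \<open>\<open>I_index\<close> is well defined on \<open>{1..}\<close>: the sets \<open>I_set s\<close> partition it.\<close>

lemma I_set_ex1:
  assumes "n \<ge> 1"
  shows "\<exists>!s. 1 \<le> s \<and> n \<in> I_set s"
proof -
  define T :: "nat \<Rightarrow> nat" where "T d = d * (d - 1) div 2" for d
  have T_Suc: "T (Suc d) = T d + d" for d
    by (cases d) (simp_all add: T_def)
  have mono: "T d \<le> T e" if "d \<le> e" for d e
    using that by (induction e rule: dec_induct) (simp_all add: T_Suc)
  have eq: "s * (s + 1) div 2 + y * s + y * (y - 1) div 2 = T (s + y) + s" for s y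
  proof -
    have "T (s + y) + s = T (Suc s) + y * s + T y"
      by (induction y) (simp_all add: T_Suc, simp add: T_def)
    then show ?thesis by (simp add: T_def mult.commute)
  qed
  have mem: "m \<in> I_set s \<longleftrightarrow> (\<exists>d\<ge>s. m = T d + s)" for m s
    unfolding I_set_def eq by (auto simp: le_iff_add)
  have ex: "\<exists>d s. 1 \<le> s \<and> s \<le> d \<and> m = T d + s" if "m \<ge> 1" for m
    using that
  proof (induction m rule: dec_induct)
    case base
    then show ?case by (intro exI[of _ 1]) (simp add: T_def)
  next
    case (step m)
    then obtain d s where ds: "1 \<le> s" "s \<le> d" "m = T d + s" by blast
    show ?case
    proof (cases "s = d")
      case True
      then show ?thesis using ds by (intro exI[of _ "Suc d"] exI[of _ 1]) (simp add: T_Suc)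
    next
      case False
      then show ?thesis using ds by (intro exI[of _ d] exI[of _ "Suc s"]) simp
    qed
  qed
  have not_less: "\<not> d < e" if "1 \<le> s" "s \<le> d" "1 \<le> s'" "T d + s = T e + s'" for d e s s'
    using mono[of "Suc d" e] that by (auto simp: T_Suc)
  have uniq: "s = s'"
    if "1 \<le> s" "s \<le> d" "1 \<le> s'" "s' \<le> e" "T d + s = T e + s'" for d e s s'
  proof -
    have "d = e" using not_less[of s d s' e] not_less[of s' e s d] that by linarith
    then show ?thesis using that by simp
  qed
  show ?thesis
    using ex[OF assms] unfolding mem by (metis uniq)
qed

lemma I_index_eq: "1 \<le> s \<Longrightarrow> n \<in> I_set s \<Longrightarrow> I_index n = s"
proof -
  assume s: "1 \<le> s" "n \<in> I_set s"
  then have "n \<ge> 1" by (cases s) (auto simp: I_set_def)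
  then show ?thesis unfolding I_index_def using s I_set_ex1 by (blast intro: the1_equality)
qed

end

theory Submission imports Defs begin

text \<open>
  The sequence \<open>t\<^sub>n = exp (- \<alpha>\<^sub>n\<^sub>+\<^sub>1)\<close> separates the two approximate diametral dimensions.

  It belongs to that of \<open>\<Lambda>\<^sub>1\<close>: the unweighted \<open>\<ell>\<^sup>1\<close> ball \<open>B\<close> is bounded there, because all
  weights are at most \<open>1\<close>, and its diameters with respect to the unit ball of the second
  seminorm are at least \<open>exp (- \<alpha>\<^sub>n\<^sub>+\<^sub>1 / 2)\<close>, the least weight among the first \<open>n + 1\<close> unit
  vectors (\<open>kolmogorov_diameter_ge\<close>).

  It does not belong to that of \<open>\<K>\<^sub>\<alpha>\<close>.  A zero neighbourhood contains a multiple of the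
  unit ball \<open>U\<^sub>k\<close> for some \<open>k\<close>, and a bounded set is contained in a multiple of
  \<open>U\<^sub>k\<^sub>+\<^sub>1\<close>.  At the infinitely many \<open>m \<in> I_set k\<close> the passage from \<open>k\<close> to \<open>k + 1\<close> switches
  the weight from \<open>exp (- \<alpha>\<^sub>m / k)\<close> to \<open>exp ((1 - 1 / (k + 1)) \<alpha>\<^sub>m)\<close>, so the quotient of the two
  weights is \<open>exp (- (1 + \<delta>) \<alpha>\<^sub>m)\<close> with \<open>\<delta> = 1 / k - 1 / (k + 1) > 0\<close>.  Beyond \<open>m\<close> the
  quotients are at most \<open>exp (- \<delta> \<alpha>\<^sub>m\<^sub>+\<^sub>1)\<close>, which instability makes smaller still.  Spanning
  the first \<open>n = m - 1\<close> coordinates therefore bounds the diameter by a multiple of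
  \<open>exp (- (1 + \<delta>) \<alpha>\<^sub>n\<^sub>+\<^sub>1)\<close> (\<open>kolmogorov_diameter_le\<close>), so that along these \<open>n\<close> the quotient
  of \<open>t\<^sub>n\<close> by the diameter does not tend to \<open>0\<close>.
\<close>


section \<open>Finite-dimensional subspaces of sequences\<close>

definition unit_seq :: "nat \<Rightarrow> nat \<Rightarrow> 'a::field"
  where "unit_seq i = (\<lambda>j. if j = i then 1 else 0)"

lemma dim_at_most_span:
  assumes "finite S" "card S \<le> n"
  shows "dim_at_most n (seq.span S)"
proof -
  obtain b where b: "b \<subseteq> S" "seq.independent b" "S \<subseteq> seq.span b"
    using seq.maximal_independent_subset[of S] .
  have "seq.span b = seq.span S"
    using b(1,3) by (intro subset_antisym seq.span_mono seq.span_minimal seq.subspace_span)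
  moreover have "finite b" "card b \<le> n"
    using finite_subset[OF b(1)] card_mono[OF _ b(1)] assms by auto
  ultimately show ?thesis unfolding dim_at_most_def using b(2) by metis
qed

lemma sum_fun_apply: "(\<Sum>i\<in>I. f i) x = (\<Sum>i\<in>I. f i x)"
  by (induction I rule: infinite_finite_induct) auto

lemma truncation_in_span_unit_seq:
  assumes "finite F"
  shows "(\<lambda>i. if i \<in> F then x i else 0) \<in> seq.span (unit_seq ` F)"
proof -
  have "(\<lambda>i. if i \<in> F then x i else 0) = (\<Sum>j\<in>F. seq_scale (x j) (unit_seq j))"
    using assms by (auto simp: fun_eq_iff sum_fun_apply seq_scale_def unit_seq_def if_distrib cong: if_cong)
  also have "\<dots> \<in> seq.span (unit_seq ` F)"
    by (intro seq.span_sum seq.span_scale seq.span_base) auto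
  finally show ?thesis .
qed

text \<open>Gaussian elimination, one equation and one unknown at a time.\<close>

lemma homogeneous_system_nontrivial_solution:
  fixes v :: "'j \<Rightarrow> 'i \<Rightarrow> 'a::field"
  assumes "finite J" "finite I" "card J < card I"
  shows "\<exists>f. (\<exists>i\<in>I. f i \<noteq> 0) \<and> (\<forall>j\<in>J. (\<Sum>i\<in>I. f i * v j i) = 0)"
  using assms
proof (induction J arbitrary: I v rule: finite_induct)
  case empty
  then have "I \<noteq> {}" by auto
  then show ?case by (intro exI[of _ "\<lambda>_. 1"]) auto
next
  case (insert k J)
  show ?case
  proof (cases "\<forall>i\<in>I. v k i = 0")
    case True
    then show ?thesis using insert.IH[of I v] insert.prems insert.hyps by auto
  next
    case False
    then obtain p where p: "p \<in> I" "v k p \<noteq> 0" by blast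
    have "card J < card (I - {p})"
      using insert.prems insert.hyps p by simp
    then obtain f where f: "\<exists>i\<in>I - {p}. f i \<noteq> 0"
        "\<forall>j\<in>J. (\<Sum>i\<in>I - {p}. f i * (v j i - v j p / v k p * v k i)) = 0"
      using insert.IH[of "I - {p}" "\<lambda>j i. v j i - v j p / v k p * v k i"] insert.prems by blast
    \<comment> \<open>The value at the pivot is forced by equation \<open>k\<close>.\<close>
    define S where "S = (\<Sum>i\<in>I - {p}. f i * v k i)"
    define g where "g = f(p := - S / v k p)"
    have sum_g: "(\<Sum>i\<in>I. g i * v j i) = (\<Sum>i\<in>I - {p}. f i * v j i) - S / v k p * v j p" for j
      using p insert.prems by (simp add: sum.remove[of I p] g_def)
    have "(\<Sum>i\<in>I. g i * v k i) = 0"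
      unfolding sum_g using p by (simp add: S_def)
    moreover have "(\<Sum>i\<in>I. g i * v j i) = 0" if "j \<in> J" for j
    proof -
      have "(\<Sum>i\<in>I - {p}. f i * (v j i - v j p / v k p * v k i))
          = (\<Sum>i\<in>I - {p}. f i * v j i) - v j p / v k p * S"
        by (simp add: S_def sum_distrib_left sum_subtractf algebra_simps)
      then show ?thesis unfolding sum_g using f(2) that by (simp add: mult.commute)
    qed
    moreover have "\<exists>i\<in>I. g i \<noteq> 0"
      using f(1) by (auto simp: g_def)
    ultimately show ?thesis by blast
  qed
qed

lemma annihilating_functional:
  fixes L :: "(nat \<Rightarrow> 'a::field) set"
  assumes "dim_at_most n L" "finite I" "n < card I"
  obtains f where "\<exists>i\<in>I. f i \<noteq> 0" "\<And>l. l \<in> L \<Longrightarrow> (\<Sum>i\<in>I. f i * l i) = 0"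
proof -
  obtain b where b: "seq.span b = L" "finite b" "card b \<le> n"
    using assms(1) unfolding dim_at_most_def by blast
  obtain f where f: "\<exists>i\<in>I. f i \<noteq> 0" "\<forall>l\<in>b. (\<Sum>i\<in>I. f i * l i) = 0"
    using homogeneous_system_nontrivial_solution[of b I "\<lambda>l. l"] b assms by auto
  have "(\<Sum>i\<in>I. f i * l i) = 0" if "l \<in> seq.span b" for l
    using that
  proof (induction rule: seq.span_induct_alt)
    case base
    show ?case by simp
  next
    case (step c x y)
    have "(\<Sum>i\<in>I. f i * (seq_scale c x + y) i) = c * (\<Sum>i\<in>I. f i * x i) + (\<Sum>i\<in>I. f i * y i)"
      by (simp add: seq_scale_def sum.distrib sum_distrib_left algebra_simps)
    then show ?case using step f(2) by simp
  qed
  then show ?thesis using that f(1) b(1) by blast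
qed


section \<open>Koethe spaces\<close>

lemma koethe_seminorm: "seminorm (koethe_space N a) k x = (\<Sum>\<^sub>\<infinity>n\<in>N. norm (x n) * a k n)"
  by (simp add: koethe_space_def)

lemma koethe_pointsI:
  assumes "\<And>n. n \<notin> N \<Longrightarrow> x n = 0"
    and "\<And>k. k \<ge> 1 \<Longrightarrow> (\<lambda>n. norm (x n) * a k n) summable_on N"
  shows "x \<in> points (koethe_space N a)"
  using assms by (simp add: koethe_space_def)

lemma koethe_pointsD:
  assumes "x \<in> points (koethe_space N a)"
  shows "n \<notin> N \<Longrightarrow> x n = 0"
    and "k \<ge> 1 \<Longrightarrow> (\<lambda>n. norm (x n) * a k n) summable_on N"
  using assms by (simp_all add: koethe_space_def)

text \<open>This comparison covers both absolutely convex combinations and truncated sequences.\<close>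

lemma koethe_dominated:
  fixes x y z :: "nat \<Rightarrow> 'a::real_normed_field"
  assumes nonneg: "\<And>k n. n \<in> N \<Longrightarrow> 0 \<le> a k n"
    and x: "x \<in> points (koethe_space N a)" and y: "y \<in> points (koethe_space N a)"
    and le: "\<And>n. norm (z n) \<le> c * norm (x n) + d * norm (y n)"
  shows "z \<in> points (koethe_space N a)"
    and "k \<ge> 1 \<Longrightarrow> seminorm (koethe_space N a) k z
      \<le> c * seminorm (koethe_space N a) k x + d * seminorm (koethe_space N a) k y"
proof -
  define w where "w k n = c * (norm (x n) * a k n) + d * (norm (y n) * a k n)" for k n
  have zw: "norm (z n) * a k n \<le> w k n" if "n \<in> N" for k n
    using mult_right_mono[OF le[of n] nonneg[OF that, of k]] by (simp add: w_def algebra_simps)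
  have sx: "(\<lambda>n. norm (x n) * a k n) summable_on N" and sy: "(\<lambda>n. norm (y n) * a k n) summable_on N"
    if "k \<ge> 1" for k
    using koethe_pointsD(2) x y that by blast+
  have sw: "w k summable_on N" if "k \<ge> 1" for k
    unfolding w_def by (intro summable_on_add summable_on_cmult_right sx sy that)
  have sz: "(\<lambda>n. norm (z n) * a k n) summable_on N" if "k \<ge> 1" for k
    by (rule summable_on_comparison_test[OF sw[OF that]]) (use zw nonneg in auto)
  have "z n = 0" if "n \<notin> N" for n
    using le[of n] koethe_pointsD(1)[OF x that] koethe_pointsD(1)[OF y that] by simp
  then show "z \<in> points (koethe_space N a)"
    using sz by (rule koethe_pointsI)
  show "seminorm (koethe_space N a) k z
      \<le> c * seminorm (koethe_space N a) k x + d * seminorm (koethe_space N a) k y" if "k \<ge> 1"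
  proof -
    have "(\<Sum>\<^sub>\<infinity>n\<in>N. norm (z n) * a k n) \<le> (\<Sum>\<^sub>\<infinity>n\<in>N. w k n)"
      using sz[OF that] sw[OF that] zw by (rule infsum_mono)
    also have "\<dots> = c * (\<Sum>\<^sub>\<infinity>n\<in>N. norm (x n) * a k n) + d * (\<Sum>\<^sub>\<infinity>n\<in>N. norm (y n) * a k n)"
      unfolding w_def using sx[OF that] sy[OF that]
      by (simp add: infsum_add infsum_cmult_right summable_on_cmult_right)
    finally show ?thesis by (simp add: koethe_seminorm)
  qed
qed

lemma absolutely_convex_koethe_ball:
  fixes N :: "nat set" and a :: "nat \<Rightarrow> nat \<Rightarrow> real"
  assumes "\<And>k n. n \<in> N \<Longrightarrow> 0 \<le> a k n" "k \<ge> 1"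
  defines "E \<equiv> koethe_space N a :: 'a::real_normed_field seminormed_space"
  shows "absolutely_convex {x \<in> points E. seminorm E k x \<le> 1}"
  unfolding absolutely_convex_def
proof (intro ballI allI impI)
  fix x y and b c :: 'a
  assume x: "x \<in> {x \<in> points E. seminorm E k x \<le> 1}" and y: "y \<in> {x \<in> points E. seminorm E k x \<le> 1}"
    and bc: "norm b + norm c \<le> 1"
  let ?z = "seq_scale b x + seq_scale c y"
  have "norm (?z n) \<le> norm b * norm (x n) + norm c * norm (y n)" for n
    using norm_triangle_ineq[of "b * x n" "c * y n"] by (simp add: seq_scale_def norm_mult)
  then have z: "?z \<in> points E" "seminorm E k ?z \<le> norm b * seminorm E k x + norm c * seminorm E k y"
    using koethe_dominated(1)[of N a x y ?z "norm b" "norm c"]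
      koethe_dominated(2)[of N a x y ?z "norm b" "norm c" k] assms x y unfolding E_def by auto
  have "norm b * seminorm E k x + norm c * seminorm E k y \<le> norm b * 1 + norm c * 1"
    using x y by (intro add_mono mult_left_mono) auto
  then show "?z \<in> {x \<in> points E. seminorm E k x \<le> 1}"
    using z bc by simp
qed

lemma zero_neighbourhood_koethe_ball:
  "k \<ge> 1 \<Longrightarrow> zero_neighbourhood E {x \<in> points E. seminorm E k x \<le> 1}"
  unfolding zero_neighbourhood_def using zero_less_one by blast


section \<open>Estimates of Kolmogorov diameters\<close>

lemma kolmogorov_diameter_le_witness:
  assumes "t > 0" "L \<subseteq> points E" "seq.subspace L" "dim_at_most n L"
    and "V \<subseteq> {seq_scale (of_real t) u + l | u l. u \<in> U \<and> l \<in> L}"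
  shows "kolmogorov_diameter E n V U \<le> t" and "0 \<le> kolmogorov_diameter E n V U"
proof -
  let ?T = "{t. t > 0 \<and> (\<exists>L. L \<subseteq> points E \<and> seq.subspace L \<and> dim_at_most n L \<and>
              V \<subseteq> {seq_scale (of_real t) u + l | u l. u \<in> U \<and> l \<in> L})}"
  have t: "t \<in> ?T" using assms by blast
  have "bdd_below ?T" by (rule bdd_belowI[of _ 0]) auto
  then show "kolmogorov_diameter E n V U \<le> t"
    unfolding kolmogorov_diameter_def using t by (intro cInf_lower)
  show "0 \<le> kolmogorov_diameter E n V U"
    unfolding kolmogorov_diameter_def using t by (intro cInf_greatest) auto
qed

text \<open>
  The approximating subspace is the span of the unit vectors in \<open>F\<close>: cutting off these
  coordinates leaves a sequence whose \<open>p\<close>-th seminorm is at most \<open>R\<close> times its \<open>q\<close>-th one.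
\<close>

lemma kolmogorov_diameter_le:
  fixes N :: "nat set" and a :: "nat \<Rightarrow> nat \<Rightarrow> real"
  defines "E \<equiv> koethe_space N a :: 'a::real_normed_field seminormed_space"
  assumes nonneg: "\<And>k n. n \<in> N \<Longrightarrow> 0 \<le> a k n" and p: "p \<ge> 1" and q: "q \<ge> 1"
    and B: "B \<subseteq> points E" "\<And>x. x \<in> B \<Longrightarrow> seminorm E q x \<le> M" and M: "M > 0"
    and U: "{x \<in> points E. seminorm E p x \<le> e} \<subseteq> U" and e: "e > 0"
    and F: "finite F" "F \<subseteq> N" "card F \<le> n"
    and R: "R > 0" "\<And>m. m \<in> N - F \<Longrightarrow> a p m \<le> R * a q m"
  shows "kolmogorov_diameter E n B U \<le> R * M / e" and "0 \<le> kolmogorov_diameter E n B U"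
proof -
  define t where "t = R * M / e"
  have t: "t > 0" using R M e by (simp add: t_def)
  define L where "L = seq.span (unit_seq ` F :: (nat \<Rightarrow> 'a) set)"
  have dim: "dim_at_most n L"
    unfolding L_def using F by (intro dim_at_most_span) (auto intro: card_image_le le_trans)
  have fin_supp: "l i = 0" if "l \<in> L" "i \<notin> F" for l i
    using that(1) unfolding L_def
    by (induction rule: seq.span_induct_alt) (use that(2) in \<open>auto simp: seq_scale_def unit_seq_def split: if_splits\<close>)
  have "l \<in> points E" if "l \<in> L" for l
    unfolding E_def
  proof (rule koethe_pointsI)
    show "l i = 0" if "i \<notin> N" for i using fin_supp \<open>l \<in> L\<close> F that by blast
    show "(\<lambda>i. norm (l i) * a k i) summable_on N" for k
      by (rule summable_on_cong_neutral[THEN iffD1, OF _ _ _ summable_on_finite[OF F(1)]])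
        (use fin_supp \<open>l \<in> L\<close> F in auto)
  qed
  then have L: "L \<subseteq> points E" by blast
  have "B \<subseteq> {seq_scale (of_real t) u + l | u l. u \<in> U \<and> l \<in> L}"
  proof
    fix x assume x: "x \<in> B"
    define l where "l = (\<lambda>i. if i \<in> F then x i else 0)"
    define u where "u = (\<lambda>i. (x i - l i) / of_real t)"
    have "l \<in> L" unfolding L_def l_def by (rule truncation_in_span_unit_seq[OF F(1)])
    have xE: "x \<in> points E" using x B by blast
    have norm_u: "norm (u i) \<le> 1 / t * norm (x i) + 0 * norm (x i)" for i
      using t by (simp add: u_def l_def norm_divide)
    have uE: "u \<in> points E"
      using koethe_dominated(1)[of N a x x u "1 / t" 0] nonneg xE norm_u unfolding E_def by blast
    have sums: "(\<lambda>i. norm (u i) * a p i) summable_on N" "(\<lambda>i. norm (x i) * a q i) summable_on N"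
      using koethe_pointsD(2) uE xE p q unfolding E_def by blast+
    have "norm (u i) * a p i \<le> R / t * (norm (x i) * a q i)" if i: "i \<in> N" for i
    proof (cases "i \<in> F")
      case True
      then show ?thesis using i R t nonneg by (simp add: u_def l_def)
    next
      case False
      then have "norm (x i) / t * a p i \<le> norm (x i) / t * (R * a q i)"
        using i R t by (intro mult_left_mono) auto
      then show ?thesis using False t by (simp add: u_def l_def norm_divide mult_ac)
    qed
    then have "(\<Sum>\<^sub>\<infinity>i\<in>N. norm (u i) * a p i) \<le> (\<Sum>\<^sub>\<infinity>i\<in>N. R / t * (norm (x i) * a q i))"
      using sums by (intro infsum_mono summable_on_cmult_right)
    also have "\<dots> = R / t * seminorm E q x"
      unfolding E_def koethe_seminorm using sums by (intro infsum_cmult_right)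
    also have "\<dots> \<le> R / t * M"
      using B(2)[OF x] R t by (intro mult_left_mono) auto
    also have "\<dots> = e" using R M e by (simp add: t_def)
    finally have "u \<in> U" using U uE by (auto simp: E_def koethe_seminorm)
    moreover have "x = seq_scale (of_real t) u + l"
      using t by (auto simp: fun_eq_iff seq_scale_def u_def)
    ultimately show "x \<in> {seq_scale (of_real t) u + l | u l. u \<in> U \<and> l \<in> L}"
      using \<open>l \<in> L\<close> by blast
  qed
  with t L dim show "kolmogorov_diameter E n B U \<le> R * M / e" "0 \<le> kolmogorov_diameter E n B U"
    using kolmogorov_diameter_le_witness[of t L E n B U] unfolding t_def L_def by auto
qed

text \<open>
  A non-zero functional on the coordinates in \<open>I\<close> that kills the \<open>n\<close>-dimensional subspace attains its
  dual norm at a multiple of some unit vector, where the inclusion \<open>B \<subseteq> t U + L\<close> forces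
  \<open>t \<ge> r\<close>.
\<close>

lemma kolmogorov_diameter_ge:
  fixes N :: "nat set" and a :: "nat \<Rightarrow> nat \<Rightarrow> real"
  defines "E \<equiv> koethe_space N a :: 'a::real_normed_field seminormed_space"
  assumes pos: "\<And>k n. n \<in> N \<Longrightarrow> 0 < a k n" and p: "p \<ge> 1"
    and U: "U \<subseteq> {x \<in> points E. seminorm E p x \<le> 1}" and BU: "B \<subseteq> U"
    and I: "finite I" "I \<subseteq> N" "n < card I"
    and B: "\<And>i. i \<in> I \<Longrightarrow> unit_seq i \<in> B" and r: "\<And>i. i \<in> I \<Longrightarrow> r \<le> a p i"
  shows "r \<le> kolmogorov_diameter E n B U"
  unfolding kolmogorov_diameter_def
proof (rule cInf_greatest)
  \<comment> \<open>The infimum is not over the empty set: \<open>t = 1\<close> and \<open>L = {0}\<close> are admissible.\<close>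
  have "B \<subseteq> {seq_scale (of_real 1) u + l | u l. u \<in> U \<and> l \<in> {0}}"
    using BU by auto
  moreover have "dim_at_most n {0 :: nat \<Rightarrow> 'a}"
    unfolding dim_at_most_def by (intro exI[of _ "{}"]) (simp add: seq.independent_empty)
  moreover have "{0 :: nat \<Rightarrow> 'a} \<subseteq> points E" by (auto simp: E_def koethe_space_def)
  ultimately show "{t. t > 0 \<and> (\<exists>L. L \<subseteq> points E \<and> seq.subspace L \<and> dim_at_most n L \<and>
      B \<subseteq> {seq_scale (of_real t) u + l | u l. u \<in> U \<and> l \<in> L})} \<noteq> {}"
    using seq.subspace_single_0 zero_less_one by blast
next
  fix t
  assume "t \<in> {t. t > 0 \<and> (\<exists>L. L \<subseteq> points E \<and> seq.subspace L \<and> dim_at_most n L \<and>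
      B \<subseteq> {seq_scale (of_real t) u + l | u l. u \<in> U \<and> l \<in> L})}"
  then obtain L where t: "t > 0" and L: "dim_at_most n L"
    and BL: "B \<subseteq> {seq_scale (of_real t) u + l | u l. u \<in> U \<and> l \<in> L}"
    by blast
  obtain f where f: "\<exists>i\<in>I. f i \<noteq> (0::'a)" "\<And>l. l \<in> L \<Longrightarrow> (\<Sum>i\<in>I. f i * l i) = 0"
    using annihilating_functional[OF L I(1,3)] by blast
  define g where "g i = norm (f i) / a p i" for i
  have "g ` I \<noteq> {}" using f(1) by blast
  then have "Max (g ` I) \<in> g ` I" using I(1) by (intro Max_in) auto
  then obtain m where m: "m \<in> I" "Max (g ` I) = g m" by auto
  have gm_ge: "g i \<le> g m" if "i \<in> I" for i
    using Max_ge[of "g ` I" "g i"] I(1) that unfolding m(2) by auto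
  have ap: "a p i > 0" if "i \<in> I" for i using that I pos by blast
  have gm: "g m > 0"
  proof -
    obtain i where i: "i \<in> I" "f i \<noteq> 0" using f(1) by blast
    then have "g i > 0" using ap[of i] by (simp add: g_def)
    then show ?thesis using gm_ge[OF i(1)] by linarith
  qed
  obtain u l where ul: "unit_seq m = seq_scale (of_real t) u + l" "u \<in> U" "l \<in> L"
    using subsetD[OF BL B[OF m(1)]] by auto
  have "f m = (\<Sum>i\<in>I. f i * unit_seq m i)"
    using m(1) I(1) by (simp add: unit_seq_def if_distrib cong: if_cong)
  also have "\<dots> = of_real t * (\<Sum>i\<in>I. f i * u i) + (\<Sum>i\<in>I. f i * l i)"
    unfolding ul(1) by (simp add: seq_scale_def sum.distrib sum_distrib_left algebra_simps)
  also have "\<dots> = of_real t * (\<Sum>i\<in>I. f i * u i)"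
    using f(2) ul by simp
  finally have "norm (f m) = t * norm (\<Sum>i\<in>I. f i * u i)"
    using t by (simp add: norm_mult)
  also have "norm (\<Sum>i\<in>I. f i * u i) \<le> g m * 1"
  proof -
    have "norm (\<Sum>i\<in>I. f i * u i) \<le> (\<Sum>i\<in>I. norm (f i * u i))" by (rule norm_sum)
    also have "\<dots> = (\<Sum>i\<in>I. g i * (norm (u i) * a p i))"
      using less_imp_neq[OF ap] by (intro sum.cong) (auto simp: g_def norm_mult)
    also have "\<dots> \<le> (\<Sum>i\<in>I. g m * (norm (u i) * a p i))"
      using gm_ge ap by (intro sum_mono mult_right_mono) (auto simp: less_imp_le)
    also have "\<dots> = g m * (\<Sum>i\<in>I. norm (u i) * a p i)"
      by (simp add: sum_distrib_left)
    also have "(\<Sum>i\<in>I. norm (u i) * a p i) \<le> seminorm E p u"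
      unfolding E_def koethe_seminorm
      using U ul(2) I pos p unfolding E_def
      by (intro finite_sum_le_infsum koethe_pointsD(2)) (auto simp: less_imp_le)
    also have "\<dots> \<le> 1" using U ul(2) by blast
    finally show ?thesis using gm by simp
  qed
  finally have "norm (f m) \<le> t * g m" using t by simp
  then have "a p m * g m \<le> t * g m"
    using ap[OF m(1)] by (simp add: g_def)
  then have "a p m \<le> t" using gm by simp
  then show "r \<le> t" using r[OF m(1)] by linarith
qed


section \<open>The separating sequence\<close>

lemma exp_in_approx_diametral_dimension_Lambda1:
  fixes \<beta> :: "nat \<Rightarrow> real"
  assumes mono: "mono \<beta>" and nonneg: "\<And>n. 0 \<le> \<beta> n" and lim: "filterlim \<beta> at_top sequentially"
  shows "(\<lambda>n. of_real (exp (- \<beta> n)))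
    \<in> approx_diametral_dimension (Lambda1 0 \<beta> :: 'a::real_normed_field seminormed_space)"
proof -
  define E where "E = (Lambda1 0 \<beta> :: 'a seminormed_space)"
  define a where "a k n = exp (- \<beta> n / real k)" for k n
  \<comment> \<open>With constant weights the \<open>\<ell>\<^sup>1\<close> ball is again a unit ball of a Koethe space.\<close>
  define l1 where "l1 = (koethe_space {0..} (\<lambda>_ _. 1) :: 'a seminormed_space)"
  have E: "E = koethe_space {0..} a" by (simp add: E_def Lambda1_def a_def[abs_def])
  have a: "0 < a k n" "a k n \<le> 1" for k n
    using nonneg by (auto simp: a_def)
  define U where "U = {x \<in> points E. seminorm E 2 x \<le> 1}"
  define B where "B = {x \<in> points l1. seminorm l1 1 x \<le> 1}"
  have convex: "absolutely_convex U" "absolutely_convex B"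
    unfolding U_def B_def E l1_def by (intro absolutely_convex_koethe_ball; use a in \<open>simp add: less_imp_le\<close>)+
  have B: "x \<in> points E" "k \<ge> 1 \<Longrightarrow> seminorm E k x \<le> 1" if "x \<in> B" for x k
  proof -
    have x: "x \<in> points l1" "seminorm l1 1 x \<le> 1"
      using that by (simp_all add: B_def)
    have s1: "(\<lambda>n. norm (x n) * 1) summable_on {0..}"
      using koethe_pointsD(2)[OF x(1)[unfolded l1_def], of 1] by simp
    have le: "norm (x n) * a k n \<le> norm (x n) * 1" for k n
      using a by (intro mult_left_mono) auto
    have s: "(\<lambda>n. norm (x n) * a k n) summable_on {0..}" for k
      by (rule summable_on_comparison_test[OF s1]) (use le a in \<open>auto simp: less_imp_le\<close>)
    show "x \<in> points E"
      unfolding E using s by (intro koethe_pointsI) auto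
    have "(\<Sum>\<^sub>\<infinity>n\<in>{0..}. norm (x n) * a k n) \<le> (\<Sum>\<^sub>\<infinity>n\<in>{0..}. norm (x n) * 1)"
      by (rule infsum_mono[OF s s1 le])
    also have "\<dots> \<le> 1" using x(2) by (simp add: l1_def koethe_seminorm)
    finally show "seminorm E k x \<le> 1" by (simp add: E koethe_seminorm)
  qed
  have bounded: "bounded_in E B"
    unfolding bounded_in_def using B by blast
  have unit: "unit_seq i \<in> B" for i
  proof -
    have has_sum: "((\<lambda>n. norm (unit_seq i n :: 'a) * 1) has_sum 1) {0..}"
    proof (rule has_sum_cong_neutral[THEN iffD1])
      show "((\<lambda>n. norm (unit_seq i n :: 'a) * 1) has_sum 1) {i}"
        using has_sum_finite[of "{i}" "\<lambda>n. norm (unit_seq i n :: 'a) * 1"]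
        by (simp add: unit_seq_def)
    qed (auto simp: unit_seq_def)
    then have "unit_seq i \<in> points l1"
      unfolding l1_def by (intro koethe_pointsI) (auto simp: summable_on_def)
    moreover have "seminorm l1 1 (unit_seq i) = 1"
      unfolding l1_def koethe_seminorm using has_sum by (rule infsumI)
    ultimately show ?thesis by (simp add: B_def)
  qed
  have diameter: "exp (- \<beta> n / 2) \<le> kolmogorov_diameter E n B U" for n
    unfolding E
  proof (rule kolmogorov_diameter_ge[where p = 2 and I = "{..n}"])
    show "exp (- \<beta> n / 2) \<le> a 2 i" if "i \<in> {..n}" for i
      using monoD[OF mono, of i n] that by (simp add: a_def)
    show "B \<subseteq> U" using B by (auto simp: U_def)
  qed (use a unit in \<open>auto simp: U_def E\<close>)
  have "(\<lambda>n. of_real (exp (- \<beta> n)) / of_real (kolmogorov_diameter E n B U) :: 'a) \<longlonglongrightarrow> 0"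
  proof (rule Lim_null_comparison)
    have "exp (- \<beta> n) / kolmogorov_diameter E n B U \<le> exp (- \<beta> n) / exp (- \<beta> n / 2)" for n
      using diameter[of n] by (intro divide_left_mono) (auto intro!: mult_pos_pos intro: less_le_trans[OF exp_gt_zero])
    also have "exp (- \<beta> n) / exp (- \<beta> n / 2) = exp (- (\<beta> n / 2))" for n
      by (simp flip: exp_diff)
    finally have "exp (- \<beta> n) / kolmogorov_diameter E n B U \<le> exp (- (\<beta> n / 2))" for n .
    moreover have "0 < kolmogorov_diameter E n B U" for n
      using diameter[of n] by (rule less_le_trans[OF exp_gt_zero])
    ultimately show "\<forall>\<^sub>F n in sequentially.
        norm (of_real (exp (- \<beta> n)) / of_real (kolmogorov_diameter E n B U) :: 'a) \<le> exp (- (\<beta> n / 2))"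
      by (simp add: norm_divide less_imp_le)
    have "filterlim (\<lambda>n. 1 / 2 * \<beta> n) at_top sequentially"
      by (rule filterlim_tendsto_pos_mult_at_top[OF tendsto_const _ lim]) simp
    then have "filterlim (\<lambda>n. - (\<beta> n / 2)) at_bot sequentially"
      by (simp add: filterlim_uminus_at_top)
    then show "(\<lambda>n. exp (- (\<beta> n / 2))) \<longlonglongrightarrow> 0"
      by (rule filterlim_compose[OF exp_at_bot])
  qed
  moreover have "kolmogorov_diameter E n B U \<noteq> 0" for n
    using diameter[of n] exp_gt_zero[of "- \<beta> n / 2"] by linarith
  moreover have "zero_neighbourhood E U"
    unfolding U_def by (rule zero_neighbourhood_koethe_ball) simp
  ultimately show ?thesis
    unfolding approx_diametral_dimension_def E_def[symmetric] using convex bounded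
    by (intro CollectI exI[of _ U] exI[of _ B]) simp
qed

lemma I_set_unbounded:
  assumes "k \<ge> 1"
  obtains m where "m \<in> I_set k" "m \<ge> n"
proof -
  have "n \<le> k * (k + 1) div 2 + n * k + n * (n - 1) div 2"
    using mult_le_mono2[OF assms, of n] by linarith
  then show ?thesis
    using that[of "k * (k + 1) div 2 + n * k + n * (n - 1) div 2"] unfolding I_set_def by blast
qed

lemma exp_notin_approx_diametral_dimension_K_space:
  fixes \<alpha> :: "nat \<Rightarrow> real"
  assumes mono: "strict_mono_on {1..} \<alpha>" and pos: "\<forall>n\<ge>1. 0 < \<alpha> n"
    and unstable: "filterlim (\<lambda>n. \<alpha> (n + 1) / \<alpha> n) at_top sequentially"
  shows "(\<lambda>n. of_real (exp (- \<alpha> (n + 1))))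
    \<notin> approx_diametral_dimension (K_space \<alpha> :: 'a::real_normed_field seminormed_space)"
proof
  define E where "E = (K_space \<alpha> :: 'a seminormed_space)"
  assume "(\<lambda>n. of_real (exp (- \<alpha> (n + 1)))) \<in> approx_diametral_dimension (K_space \<alpha> :: 'a seminormed_space)"
  then obtain U B where U: "zero_neighbourhood E U" and B: "bounded_in E B"
    and lim: "(\<lambda>n. of_real (exp (- \<alpha> (n + 1))) / of_real (kolmogorov_diameter E n B U) :: 'a) \<longlonglongrightarrow> 0"
    and nz: "\<forall>\<^sub>F n in sequentially. kolmogorov_diameter E n B U = 0 \<longrightarrow> of_real (exp (- \<alpha> (n + 1))) = (0::'a)"
    unfolding approx_diametral_dimension_def E_def by blast
  obtain k e where k: "k \<ge> 1" and e: "e > 0" and Uk: "{x \<in> points E. seminorm E k x \<le> e} \<subseteq> U"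
    using U unfolding zero_neighbourhood_def by blast
  obtain M' where M': "\<forall>x\<in>B. seminorm E (k + 1) x \<le> M'"
    using B unfolding bounded_in_def by force
  define M where "M = max M' 1"
  have M: "M > 0" "\<And>x. x \<in> B \<Longrightarrow> seminorm E (k + 1) x \<le> M"
    using M' by (auto simp: M_def)
  define \<delta> where "\<delta> = 1 / real k - 1 / real (k + 1)"
  have \<delta>: "\<delta> > 0" using k by (simp add: \<delta>_def frac_less2)
  \<comment> \<open>Instability makes the next exponent dominate at all later indices.\<close>
  have "\<forall>\<^sub>F n in sequentially. \<alpha> (Suc n + 1) / \<alpha> (Suc n) \<ge> (1 + \<delta>) / \<delta>"
    using unstable[THEN filterlim_compose, OF filterlim_Suc] unfolding filterlim_at_top by blast
  then have ev1: "\<forall>\<^sub>F n in sequentially. (1 + \<delta>) * \<alpha> (n + 1) \<le> \<delta> * \<alpha> (n + 2)"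
  proof eventually_elim
    case (elim n)
    have "\<alpha> (Suc n) > 0" using pos by simp
    with elim \<delta> show ?case by (simp add: field_simps)
  qed
  have ev2: "\<forall>\<^sub>F n in sequentially.
      norm (of_real (exp (- \<alpha> (n + 1))) / of_real (kolmogorov_diameter E n B U) :: 'a) < e / M"
    using tendstoD[OF lim, of "e / M"] e M by simp
  \<comment> \<open>The sequence has no zeros, so almost all of the diameters are non-zero.\<close>
  obtain n0 where n0: "\<And>n. n \<ge> n0 \<Longrightarrow> (1 + \<delta>) * \<alpha> (n + 1) \<le> \<delta> * \<alpha> (n + 2)"
    "\<And>n. n \<ge> n0 \<Longrightarrow> norm (of_real (exp (- \<alpha> (n + 1))) / of_real (kolmogorov_diameter E n B U) :: 'a) < e / M"
    "\<And>n. n \<ge> n0 \<Longrightarrow> kolmogorov_diameter E n B U \<noteq> 0"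
    using eventually_conj[OF ev1 eventually_conj[OF ev2 nz]]
    unfolding eventually_sequentially by auto
  obtain m where m: "m \<in> I_set k" "m \<ge> n0 + 1" using I_set_unbounded[OF k] by blast
  define n where "n = m - 1"
  have n: "n + 1 = m" "n \<ge> n0" using m by (auto simp: n_def)
  define R where "R = exp (- (1 + \<delta>) * \<alpha> (n + 1))"
  have weights: "K_weight \<alpha> k i \<le> R * K_weight \<alpha> (k + 1) i" if i: "i \<in> {1..} - {1..n}" for i
  proof (cases "i = n + 1")
    case True
    then have "I_index i = k" using I_index_eq[OF k m(1)] n by simp
    then show ?thesis
      by (simp add: K_weight_def R_def True \<delta>_def flip: exp_add) (simp add: algebra_simps)
  next
    case False
    then have "i \<ge> n + 2" using i by auto
    then have "\<alpha> (n + 2) \<le> \<alpha> i"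
      using mono by (auto simp: strict_mono_on_leD)
    then have "(1 + \<delta>) * \<alpha> (n + 1) \<le> \<delta> * \<alpha> i"
      using n0(1)[OF n(2)] \<delta> by (meson mult_left_mono less_imp_le order_trans)
    then have "exp (- \<delta> * \<alpha> i) \<le> R"
      by (simp add: R_def algebra_simps)
    then have "exp (- \<delta> * \<alpha> i) * K_weight \<alpha> (k + 1) i \<le> R * K_weight \<alpha> (k + 1) i"
      by (rule mult_right_mono) (simp add: K_weight_def)
    moreover have "K_weight \<alpha> k i \<le> exp (- \<delta> * \<alpha> i) * K_weight \<alpha> (k + 1) i"
      using pos i by (auto simp: K_weight_def \<delta>_def algebra_simps simp flip: exp_add)
    ultimately show ?thesis by linarith
  qed
  have E: "E = koethe_space {1..} (K_weight \<alpha>)" by (simp add: E_def K_space_def)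
  note bounds = kolmogorov_diameter_le[where N = "{1..}" and a = "K_weight \<alpha>" and p = k and q = "k + 1"
      and F = "{1..n}" and n = n and R = R and M = M and e = e and B = B and U = U, folded E]
  have d: "kolmogorov_diameter E n B U \<le> R * M / e" "0 \<le> kolmogorov_diameter E n B U"
    using bounds k M e Uk weights B by (auto simp: K_weight_def R_def bounded_in_def)
  then have dpos: "kolmogorov_diameter E n B U > 0" using n0(3)[OF n(2)] by linarith
  have "R \<le> exp (- \<alpha> (n + 1))"
    using mult_pos_pos[OF \<delta>, of "\<alpha> (n + 1)"] pos by (simp add: R_def algebra_simps)
  then have "R * M / e \<le> exp (- \<alpha> (n + 1)) * M / e"
    using M e by (intro divide_right_mono mult_right_mono) auto
  with d(1) have "kolmogorov_diameter E n B U \<le> exp (- \<alpha> (n + 1)) * M / e" by linarith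
  then have "e / M \<le> exp (- \<alpha> (n + 1)) / kolmogorov_diameter E n B U"
    using dpos M e by (simp add: field_simps)
  moreover have "exp (- \<alpha> (n + 1)) / kolmogorov_diameter E n B U < e / M"
    using n0(2)[OF n(2)] dpos by (simp add: norm_divide)
  ultimately show False by linarith
qed

theorem proposition3p7:
  fixes \<alpha> :: "nat \<Rightarrow> real"
  assumes "strict_mono_on {1..} \<alpha>"
    and "\<forall>n\<ge>1. 0 < \<alpha> n"
    and "nuclear_space (Lambda1 1 \<alpha> :: 'a::real_normed_field seminormed_space)"
    and "filterlim (\<lambda>n. \<alpha> (n + 1) / \<alpha> n) at_top sequentially"
  shows "approx_diametral_dimension (K_space \<alpha> :: 'a seminormed_space)
       \<noteq> approx_diametral_dimension (Lambda1 0 (\<lambda>n. \<alpha> (n + 1)) :: 'a seminormed_space)"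
proof -
  have mono: "\<alpha> i \<le> \<alpha> j" if "1 \<le> i" "i \<le> j" for i j
    using assms(1) that by (auto simp: strict_mono_on_leD)
  have "filterlim (\<lambda>n. \<alpha> 1 * (\<alpha> (n + 1) / \<alpha> n)) at_top sequentially"
    by (rule filterlim_tendsto_pos_mult_at_top[OF tendsto_const _ assms(4)]) (use assms(2) in simp)
  then have "filterlim (\<lambda>n. \<alpha> (n + 1)) at_top sequentially"
  proof (rule filterlim_at_top_mono)
    have "\<alpha> 1 * (\<alpha> (n + 1) / \<alpha> n) \<le> \<alpha> (n + 1)" if "n \<ge> 1" for n
      using mult_right_mono[OF mono[of 1 n], of "\<alpha> (n + 1)"] that assms(2) by (simp add: field_simps less_imp_le)
    then show "\<forall>\<^sub>F n in sequentially. \<alpha> 1 * (\<alpha> (n + 1) / \<alpha> n) \<le> \<alpha> (n + 1)"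
      using eventually_sequentially by blast
  qed
  then have "(\<lambda>n. of_real (exp (- \<alpha> (n + 1))))
      \<in> approx_diametral_dimension (Lambda1 0 (\<lambda>n. \<alpha> (n + 1)) :: 'a seminormed_space)"
    using mono assms(2)
    by (intro exp_in_approx_diametral_dimension_Lambda1) (auto simp: mono_def less_imp_le)
  with exp_notin_approx_diametral_dimension_K_space[OF assms(1,2,4)] show ?thesis by metis
qed

end
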